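(* Let $X=\mathbb{N}^{<\omega}\cup\{\infty\}$, where $\mathbb{N}^{<\omega}$ is the set of finite sequences of natural numbers and $\infty\notin\mathbb{N}^{<\omega}$, be partially ordered by $$x\leqslant y\iff (x,y\in\mathbb{N}^{<\omega}\text{ and }x\subseteq y)\ \text{ or }\ y=\infty,$$ where $x\subseteq y$ means that $x$ is an initial segment of $y$, and endow $X$ with the Scott topology of this order. Then the family $\mathcal{M}(X)$ of monitorable subsets of $X$ is a complete coanalytic (i.e. $\boldsymbol{\Pi}^1_1$-complete) subset of $\mathcal{P}(X)$.
   Context: In the Scott topology considered, a subset of $X$ is open if and only if it is either empty or an upward closed set intersecting every infinite branch of $\mathbb{N}^{<\omega}$ (an infinite branch being the set of all finite initial segments of some $\alpha\in\mathbb{N}^{\mathbb{N}}$). A subset $A\subseteq X$ is dense in an open set $U$ if $U\subseteq\overline{A}$, and codense in $U$ if $U\subseteq\overline{X\setminus A}$. $A$ is monitorable if for every non-empty open set $U\subseteq X$ either $A$ is not dense in $U$ or $A$ is not codense in $U$; $\mathcal{M}(X)\subseteq\mathcal{P}(X)$ is the family of monitorable subsets. The powerset $\mathcal{P}(X)$ is identified with $2^X$ via characteristic functions and carries the product topology (with $2=\{0,1\}$ discrete), so it is homeomorphic to the Cantor space. A subset of a Polish space $Z$ is analytic ($\boldsymbol{\Sigma}^1_1$) if it is the range of a continuous function from some Polish space to $Z$ (as usual, the empty set is analytic), and coanalytic ($\boldsymbol{\Pi}^1_1$) if its complement is analytic. A set $A\subseteq Z$ is $\boldsymbol{\Pi}^1_1$-complete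 if it is $\boldsymbol{\Pi}^1_1$ and for every zero-dimensional Polish space $Y$ and every $\boldsymbol{\Pi}^1_1$ set $B\subseteq Y$ there is a continuous $f:Y\to Z$ with $B=f^{-1}(A)$. *)

theory Defs
  imports "HOL-Analysis.Analysis" "HOL-Library.Sublist"
begin

section \<open>The Scott topology of a partial order\<close>

definition directed_set :: "'a::order set \<Rightarrow> bool" where
  "directed_set D \<longleftrightarrow> D \<noteq> {} \<and> (\<forall>x\<in>D. \<forall>y\<in>D. \<exists>z\<in>D. x \<le> z \<and> y \<le> z)"

definition is_supremum :: "'a::order set \<Rightarrow> 'a \<Rightarrow> bool" where
  "is_supremum D s \<longleftrightarrow> (\<forall>x\<in>D. x \<le> s) \<and> (\<forall>u. (\<forall>x\<in>D. x \<le> u) \<longrightarrow> s \<le> u)"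

definition scott_open :: "'a::order set \<Rightarrow> bool" where
  "scott_open U \<longleftrightarrow>
     (\<forall>x\<in>U. \<forall>y. x \<le> y \<longrightarrow> y \<in> U) \<and>
     (\<forall>D s. directed_set D \<and> is_supremum D s \<and> s \<in> U \<longrightarrow> D \<inter> U \<noteq> {})"

definition scott_topology :: "'a::order topology" where
  "scott_topology = topology scott_open"

lemma scott_openD:
  assumes "scott_open U"
  shows "x \<in> U \<Longrightarrow> x \<le> y \<Longrightarrow> y \<in> U"
    and "directed_set D \<Longrightarrow> is_supremum D s \<Longrightarrow> s \<in> U \<Longrightarrow> \<exists>d\<in>D. d \<in> U"
proof -
  assume "x \<in> U" "x \<le> y"
  with assms show "y \<in> U" unfolding scott_open_def by simp
next
  assume "directed_set D" "is_supremum D s" "s \<in> U"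
  with assms have "D \<inter> U \<noteq> {}" unfolding scott_open_def by metis
  then show "\<exists>d\<in>D. d \<in> U" by (auto simp: disjoint_iff)
qed

lemma scott_openI:
  assumes "\<And>x y. x \<in> U \<Longrightarrow> x \<le> y \<Longrightarrow> y \<in> U"
    and "\<And>D s. directed_set D \<Longrightarrow> is_supremum D s \<Longrightarrow> s \<in> U \<Longrightarrow> \<exists>d\<in>D. d \<in> U"
  shows "scott_open U"
  unfolding scott_open_def
proof (intro conjI allI impI ballI)
  fix D s assume "directed_set D \<and> is_supremum D s \<and> s \<in> U"
  then have "\<exists>d\<in>D. d \<in> U" using assms(2)[of D s] by simp
  then show "D \<inter> U \<noteq> {}" by (auto simp: disjoint_iff)
qed (rule assms(1))

lemma istopology_scott_open: "istopology (scott_open :: 'a::order set \<Rightarrow> bool)"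
  unfolding istopology_def
proof (intro conjI allI impI)
  fix U V :: "'a set"
  assume U: "scott_open U" and V: "scott_open V"
  show "scott_open (U \<inter> V)"
  proof (rule scott_openI)
    fix x y assume "x \<in> U \<inter> V" "x \<le> y"
    then show "y \<in> U \<inter> V" using scott_openD(1)[OF U, of x y] scott_openD(1)[OF V, of x y] by simp
  next
    fix D s assume D: "directed_set D" "is_supremum D s" and s: "s \<in> U \<inter> V"
    obtain x where x: "x \<in> D" "x \<in> U" using scott_openD(2)[OF U D] s by auto
    obtain y where y: "y \<in> D" "y \<in> V" using scott_openD(2)[OF V D] s by auto
    obtain z where z: "z \<in> D" "x \<le> z" "y \<le> z"
      using D(1) x(1) y(1) unfolding directed_set_def by metis
    show "\<exists>d\<in>D. d \<in> U \<inter> V"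
      using z(1) scott_openD(1)[OF U x(2) z(2)] scott_openD(1)[OF V y(2) z(3)] by auto
  qed
next
  fix K :: "'a set set"
  assume K: "\<forall>U\<in>K. scott_open U"
  show "scott_open (\<Union>K)"
  proof (rule scott_openI)
    fix x y assume "x \<in> \<Union>K" "x \<le> y"
    then obtain U where "U \<in> K" "x \<in> U" by blast
    then have "y \<in> U" using K \<open>x \<le> y\<close> scott_openD(1)[of U x y] by simp
    with \<open>U \<in> K\<close> show "y \<in> \<Union>K" by blast
  next
    fix D s assume D: "directed_set D" "is_supremum D s" and "s \<in> \<Union>K"
    then obtain U where U: "U \<in> K" "s \<in> U" by blast
    then obtain d where "d \<in> D" "d \<in> U" using K D scott_openD(2)[of U D s] by auto
    with U(1) show "\<exists>d\<in>D. d \<in> \<Union>K" by blast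
  qed
qed

lemma openin_scott_topology: "openin scott_topology U \<longleftrightarrow> scott_open U"
  unfolding scott_topology_def by (simp add: istopology_scott_open topology_inverse')

lemma topspace_scott_topology [simp]: "topspace scott_topology = UNIV"
proof -
  have "scott_open (UNIV :: 'a set)"
    by (rule scott_openI) (auto simp: directed_set_def)
  then have "openin scott_topology (UNIV :: 'a set)"
    by (simp add: openin_scott_topology)
  then show ?thesis
    using openin_subset by auto
qed


section \<open>Finite sequences of natural numbers with a top element\<close>

datatype tree_top = Seq "nat list" | Infty

instantiation tree_top :: order
begin

definition less_eq_tree_top :: "tree_top \<Rightarrow> tree_top \<Rightarrow> bool" where
  "x \<le> y \<longleftrightarrow> (\<exists>s t. x = Seq s \<and> y = Seq t \<and> prefix s t) \<or> y = Infty"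

definition less_tree_top :: "tree_top \<Rightarrow> tree_top \<Rightarrow> bool" where
  "x < y \<longleftrightarrow> x \<le> y \<and> \<not> y \<le> (x :: tree_top)"

instance
proof
  fix x y z :: tree_top
  show "x < y \<longleftrightarrow> x \<le> y \<and> \<not> y \<le> x" by (rule less_tree_top_def)
  show "x \<le> x" by (cases x) (auto simp: less_eq_tree_top_def)
  show "x \<le> y \<Longrightarrow> y \<le> z \<Longrightarrow> x \<le> z"
    by (cases x) (auto simp: less_eq_tree_top_def)
  show "x \<le> y \<Longrightarrow> y \<le> x \<Longrightarrow> x = y"
    by (auto simp: less_eq_tree_top_def)
qed

end

lemma tree_top_le_simps [simp]:
  "Seq s \<le> Seq t \<longleftrightarrow> prefix s t" "x \<le> Infty" "\<not> Infty \<le> Seq s"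
  by (auto simp: less_eq_tree_top_def)

definition infinite_branch :: "(nat \<Rightarrow> nat) \<Rightarrow> tree_top set" where
  "infinite_branch \<alpha> = range (\<lambda>n. Seq (map \<alpha> [0..<n]))"

lemma prefix_map_upt: "m \<le> n \<Longrightarrow> prefix (map \<alpha> [0..<m]) (map \<alpha> [0..<n])"
  by (metis le_iff_add map_append prefixI upt_add_eq_append zero_le)

lemma openin_scott_tree_top:
  "openin scott_topology U \<longleftrightarrow>
     U = {} \<or> ((\<forall>x\<in>U. \<forall>y. x \<le> y \<longrightarrow> y \<in> U) \<and> (\<forall>\<alpha>. U \<inter> infinite_branch \<alpha> \<noteq> {}))"
proof
  assume "openin scott_topology U"
  then have up: "\<forall>x\<in>U. \<forall>y. x \<le> y \<longrightarrow> y \<in> U"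
    and lim: "\<And>D s. directed_set D \<Longrightarrow> is_supremum D s \<Longrightarrow> s \<in> U \<Longrightarrow> D \<inter> U \<noteq> {}"
    by (auto simp: openin_scott_topology scott_open_def)
  have "U \<inter> infinite_branch \<alpha> \<noteq> {}" if "U \<noteq> {}" for \<alpha>
  proof -
    have "Infty \<in> U" using that up by (metis ex_in_conv tree_top_le_simps(2))
    moreover have "directed_set (infinite_branch \<alpha>)"
      unfolding directed_set_def
    proof (intro conjI ballI)
      show "infinite_branch \<alpha> \<noteq> {}" by (simp add: infinite_branch_def)
      fix x y assume "x \<in> infinite_branch \<alpha>" "y \<in> infinite_branch \<alpha>"
      then obtain m n where "x = Seq (map \<alpha> [0..<m])" "y = Seq (map \<alpha> [0..<n])"
        by (auto simp: infinite_branch_def)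
      then show "\<exists>z\<in>infinite_branch \<alpha>. x \<le> z \<and> y \<le> z"
        by (intro bexI[of _ "Seq (map \<alpha> [0..<max m n])"])
           (auto simp: infinite_branch_def intro!: prefix_map_upt)
    qed
    moreover have "is_supremum (infinite_branch \<alpha>) Infty"
      unfolding is_supremum_def
    proof (intro conjI allI impI)
      fix u assume u: "\<forall>x\<in>infinite_branch \<alpha>. x \<le> u"
      show "Infty \<le> u"
      proof (cases u)
        case (Seq t)
        with u have "prefix (map \<alpha> [0..<Suc (length t)]) t"
          unfolding infinite_branch_def by (metis rangeI tree_top_le_simps(1))
        then show ?thesis using prefix_length_le by fastforce
      qed auto
    qed auto
    ultimately show ?thesis using lim by blast
  qed
  with up show "U = {} \<or> ((\<forall>x\<in>U. \<forall>y. x \<le> y \<longrightarrow> y \<in> U) \<and> (\<forall>\<alpha>. U \<inter> infinite_branch \<alpha> \<noteq> {}))"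
    by (cases "U = {}") simp_all
next
  assume U: "U = {} \<or> ((\<forall>x\<in>U. \<forall>y. x \<le> y \<longrightarrow> y \<in> U) \<and> (\<forall>\<alpha>. U \<inter> infinite_branch \<alpha> \<noteq> {}))"
  have lim: "D \<inter> U \<noteq> {}"
    if up: "\<forall>x\<in>U. \<forall>y. x \<le> y \<longrightarrow> y \<in> U" and br: "\<forall>\<alpha>. U \<inter> infinite_branch \<alpha> \<noteq> {}"
      and D: "directed_set D" and s: "is_supremum D s" and sU: "s \<in> U" for D s
  proof (cases "s \<in> D")
    case False
    have noInf: "Infty \<notin> D"
      using s False unfolding is_supremum_def by (metis order_antisym tree_top_le_simps(2))
    define L where "L = {l. Seq l \<in> D}"
    have DL: "D = Seq ` L"
      using noInf by (auto simp: L_def) (metis imageI mem_Collect_eq tree_top.exhaust)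
    have cmp: "prefix l l'" if l: "l \<in> L" "l' \<in> L" "length l \<le> length l'" for l l'
    proof -
      obtain z where "z \<in> D" "Seq l \<le> z" "Seq l' \<le> z"
        using D l unfolding directed_set_def L_def by blast
      then obtain k where "prefix l k" "prefix l' k" using DL by auto
      then show ?thesis using l(3) prefix_length_prefix by blast
    qed
    have unb: "\<exists>l\<in>L. n < length l" for n
    proof (rule ccontr)
      assume "\<not> ?thesis"
      then have bd: "\<forall>l\<in>L. length l \<le> n" by auto
      obtain l0 where "l0 \<in> L" using D DL by (auto simp: directed_set_def)
      then obtain m where m: "m \<in> L" "\<forall>l\<in>L. length l \<le> length m"
        using bd ex_has_greatest_nat[of "\<lambda>l. l \<in> L" l0 length "Suc n"]
        by (auto simp: less_Suc_eq_le)
      then have "\<forall>x\<in>D. x \<le> Seq m" using DL cmp by auto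
      then have "s = Seq m"
        using s m(1) DL unfolding is_supremum_def by (meson imageI order_antisym)
      then show False using False m(1) DL by blast
    qed
    define pick where "pick n = (SOME l. l \<in> L \<and> n < length l)" for n
    have pick: "pick n \<in> L" "n < length (pick n)" for n
      using someI_ex[of "\<lambda>l. l \<in> L \<and> n < length l"] unb[of n] unfolding pick_def by auto
    define \<alpha> where "\<alpha> n = pick n ! n" for n
    obtain n where n: "Seq (map \<alpha> [0..<n]) \<in> U"
      using br by (auto simp: infinite_branch_def disjoint_iff)
    have "prefix (map \<alpha> [0..<n]) (pick n)"
    proof -
      have "map \<alpha> [0..<n] = take n (pick n)"
      proof (rule nth_equalityI)
        show "length (map \<alpha> [0..<n]) = length (take n (pick n))" using pick(2)[of n] by simp
        fix i assume "i < length (map \<alpha> [0..<n])"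
        then have i: "i < n" by simp
        have "pick i ! i = pick n ! i"
        proof (cases "length (pick i) \<le> length (pick n)")
          case True
          then show ?thesis using cmp pick by (metis prefixE nth_append)
        next
          case False
          then have "prefix (pick n) (pick i)" using cmp pick by simp
          then show ?thesis using i pick(2)[of n] by (metis prefixE nth_append order_less_trans)
        qed
        then show "map \<alpha> [0..<n] ! i = take n (pick n) ! i" using i by (simp add: \<alpha>_def)
      qed
      then show ?thesis by (simp add: take_is_prefix)
    qed
    then have "Seq (pick n) \<in> U" using n up by (meson tree_top_le_simps(1))
    then show ?thesis using pick(1) DL by blast
  qed (use sU in blast)
  show "openin scott_topology U"
  proof (cases "U = {}")
    case False
    with U have up: "\<forall>x\<in>U. \<forall>y. x \<le> y \<longrightarrow> y \<in> U"
      and br: "\<forall>\<alpha>. U \<inter> infinite_branch \<alpha> \<noteq> {}"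
      by simp_all
    show ?thesis
      unfolding openin_scott_topology scott_open_def
    proof (intro conjI allI impI)
      fix D s assume "directed_set D \<and> is_supremum D s \<and> s \<in> U"
      then show "D \<inter> U \<noteq> {}" by (intro lim[OF up br, of D s]) simp_all
    qed (fact up)
  qed simp
qed


section \<open>Monitorable sets\<close>

definition monitorable :: "'a topology \<Rightarrow> 'a set \<Rightarrow> bool" where
  "monitorable T A \<longleftrightarrow>
     (\<forall>U. openin T U \<and> U \<noteq> {} \<longrightarrow>
        \<not> U \<subseteq> T closure_of A \<or> \<not> U \<subseteq> T closure_of (topspace T - A))"

definition monitorable_sets :: "'a topology \<Rightarrow> 'a set set" where
  "monitorable_sets T = {A. A \<subseteq> topspace T \<and> monitorable T A}"


section \<open>The topology of the powerset\<close>

definition powerset_topology :: "'a set topology" where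
  "powerset_topology =
     pullback_topology UNIV (\<lambda>A x. x \<in> A)
       (product_topology (\<lambda>_. discrete_topology (UNIV :: bool set)) UNIV)"


section \<open>Analytic and coanalytic sets\<close>

definition polish :: "'a topology \<Rightarrow> bool" where
  "polish T \<longleftrightarrow> completely_metrizable_space T \<and> separable_space T"

text \<open>The Polish space in the definition of an analytic set is carried by a subset of
  Baire space. Nothing is lost: a Polish space has at most continuum many points; see
  \<open>analytic_in_image\<close> below, where the type of the Polish space is arbitrary.\<close>

definition analytic_in :: "'a topology \<Rightarrow> 'a set \<Rightarrow> bool" where
  "analytic_in Z A \<longleftrightarrow> polish Z \<and>
     (\<exists>(P :: (nat \<Rightarrow> nat) topology) f. polish P \<and> continuous_map P Z f \<and> f ` topspace P = A)"

definition coanalytic_in :: "'a topology \<Rightarrow> 'a set \<Rightarrow> bool" where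
  "coanalytic_in Z A \<longleftrightarrow> A \<subseteq> topspace Z \<and> analytic_in Z (topspace Z - A)"

lemma analytic_in_image:
  fixes P :: "'p topology"
  assumes Z: "polish Z" and P: "polish P" and f: "continuous_map P Z f"
  shows "analytic_in Z (f ` topspace P)"
proof -
  obtain M d where Md: "Metric_space M d" and PM: "P = Metric_space.mtopology M d"
    using P unfolding polish_def completely_metrizable_space_def by blast
  interpret Metric_space M d by (fact Md)
  have topP: "topspace P = M" by (simp add: PM)
  obtain C where C: "countable C" "C \<subseteq> M" "mtopology closure_of C = M"
    using P unfolding polish_def separable_space_def PM by auto
  define S where "S = C \<times> (\<rat> :: real set)"
  have S: "countable S" unfolding S_def using C(1) countable_rat by blast
  define g :: "'p \<Rightarrow> nat \<Rightarrow> nat" where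
    "g x n = (if \<exists>c q. (c, q) \<in> S \<and> d c x < q \<and> n = to_nat_on S (c, q) then 1 else 0)" for x n
  have inj: "inj_on g (topspace P)"
  proof (rule inj_onI, rule ccontr)
    fix x y assume xy: "x \<in> topspace P" "y \<in> topspace P" "g x = g y" "x \<noteq> y"
    then have M: "x \<in> M" "y \<in> M" by (simp_all add: topP)
    have "d x y / 2 > 0" using M xy(4) by simp
    moreover have "x \<in> mtopology closure_of C" using M C(3) by simp
    ultimately obtain c where c: "c \<in> C" "c \<in> mball x (d x y / 2)"
      unfolding metric_closure_of by blast
    then have cM: "c \<in> M" and cx: "d c x < d x y / 2" by (auto simp: commute)
    have "d x y \<le> d c x + d c y" using triangle[OF M(1) cM M(2)] by (simp add: commute)
    then have "d c x < d c y" using cx by linarith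
    then obtain q where q: "q \<in> \<rat>" "d c x < q" "q < d c y" using Rats_dense_in_real by blast
    have cq: "(c, q) \<in> S" using c q by (simp add: S_def)
    then have "g x (to_nat_on S (c, q)) = 1" using q unfolding g_def by auto
    then have "g y (to_nat_on S (c, q)) = 1" using xy(3) by simp
    then have "\<exists>c' q'. (c', q') \<in> S \<and> d c' y < q' \<and>
        to_nat_on S (c, q) = to_nat_on S (c', q')"
      unfolding g_def by (meson zero_neq_one)
    then obtain c' q' where c': "(c', q') \<in> S" "d c' y < q'"
        "to_nat_on S (c, q) = to_nat_on S (c', q')"
      by blast
    have "(c, q) = (c', q')"
      by (rule inj_onD[OF inj_on_to_nat_on[OF S] c'(3) cq c'(1)])
    with c'(2) have "d c y < q" by simp
    then show False using q by simp
  qed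
  define h where "h = inv_into (topspace P) g"
  define Q where "Q = pullback_topology (g ` topspace P) h P"
  have topQ: "topspace Q = g ` topspace P"
    unfolding Q_def topspace_pullback_topology h_def using inj by auto
  have hg: "h (g x) = x" if "x \<in> topspace P" for x
    using that inj by (simp add: h_def)
  have ch: "continuous_map Q P h"
    unfolding Q_def using continuous_map_pullback[OF continuous_map_id] by (simp add: o_def id_def)
  have cg: "continuous_map P Q g"
    unfolding Q_def
  proof (rule continuous_map_pullback')
    show "continuous_map P P (h \<circ> g)"
      by (rule continuous_map_eq[OF continuous_map_id]) (simp add: hg)
  qed auto
  have "homeomorphic_maps P Q g h"
    unfolding homeomorphic_maps_def using ch cg hg topQ by auto
  then have "P homeomorphic_space Q" unfolding homeomorphic_space_def by blast
  then have "polish Q"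
    using P homeomorphic_completely_metrizable_space[of P Q] homeomorphic_separable_space[of P Q]
    unfolding polish_def by simp
  moreover have "continuous_map Q Z (f \<circ> h)" by (rule continuous_map_compose[OF ch f])
  moreover have "(f \<circ> h) ` topspace Q = f ` topspace P"
    unfolding topQ image_image by (rule image_cong) (simp_all add: hg)
  ultimately show ?thesis
    unfolding analytic_in_def by (intro conjI Z exI[of _ Q] exI[of _ "f \<circ> h"])
qed

text \<open>HOL cannot quantify over types inside a definition, so the type of the points of the
  test space \<open>Y\<close> is a parameter; a statement with \<open>'y\<close> left free covers all \<open>Y\<close>.
  Zero-dimensionality is \<^term>\<open>Y dim_le 0\<close>, the existence of a neighbourhood base of clopen
  sets (\<open>dimension_le_0_neighbourhood_base_of_clopen\<close>).\<close>

definition coanalytic_complete :: "'y itself \<Rightarrow> 'a topology \<Rightarrow> 'a set \<Rightarrow> bool" where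
  "coanalytic_complete _ Z A \<longleftrightarrow> coanalytic_in Z A \<and>
     (\<forall>(Y :: 'y topology) B. polish Y \<and> Y dim_le 0 \<and> coanalytic_in Y B \<longrightarrow>
        (\<exists>f. continuous_map Y Z f \<and> B = {y \<in> topspace Y. f y \<in> A}))"

end

theory Submission
  imports Defs
begin

text \<open>Any two nonempty Scott open sets meet in the top element, so \<open>A\<close> is monitorable iff it contains or
  avoids a nonempty open set, i.e. iff every branch has an initial segment all of whose extensions
  agree with the top element about membership in \<open>A\<close>. This is a universal quantifier over Baire
  space followed by a Borel condition on \<open>A\<close>, hence coanalytic. Conversely, given
  an analytic \<open>E = f(P)\<close> in a zero-dimensional \<open>Y\<close>, finite sequences record approximations to a
  point of \<open>P\<close> whose image lies in the same basic clopen sets as \<open>y\<close>; an infinite branch of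
  consistent approximations converges to a preimage of \<open>y\<close>. Removing these sequences from \<open>X\<close>
  gives the reduction.\<close>

section \<open>Polish spaces\<close>

lemma polish_imp_Hausdorff_space: "polish T \<Longrightarrow> Hausdorff_space T"
  unfolding polish_def
  by (simp add: completely_metrizable_imp_metrizable_space metrizable_imp_Hausdorff_space)

text \<open>Balls of radius 1/(n+1) centred in a countable dense set form a base. Countability of
  some base is what the enumeration of clopen sets starts from.\<close>

lemma polish_imp_second_countable:
  assumes "polish T"
  shows "second_countable T"
proof -
  obtain M d where Md: "Metric_space M d" and T: "T = Metric_space.mtopology M d"
    using assms unfolding polish_def completely_metrizable_space_def by blast
  interpret Metric_space M d by (fact Md)
  obtain C where C: "countable C" "C \<subseteq> M" "mtopology closure_of C = M"
    using assms unfolding polish_def separable_space_def T by auto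
  define \<B> where "\<B> = (\<lambda>(c, n). mball c (inverse (real (Suc n)))) ` (C \<times> UNIV)"
  have "\<exists>V\<in>\<B>. x \<in> V \<and> V \<subseteq> U" if U: "openin mtopology U" "x \<in> U" for U x
  proof -
    have x: "x \<in> M" using U openin_subset by fastforce
    obtain r where r: "r > 0" "mball x r \<subseteq> U" using U unfolding openin_mtopology by blast
    obtain n where n: "inverse (real (Suc n)) < r / 2"
      using reals_Archimedean[of "r / 2"] r(1) by auto
    define q where "q = inverse (real (Suc n))"
    have "x \<in> mtopology closure_of C" using x C(3) by simp
    moreover have "q > 0" by (simp add: q_def)
    ultimately obtain c where c: "c \<in> C" "c \<in> mball x q"
      unfolding metric_closure_of by blast
    have "mball c q \<subseteq> mball x r"
    proof
      fix y assume y: "y \<in> mball c q"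
      then have "d x y \<le> d x c + d c y" using x c by (intro triangle) auto
      then show "y \<in> mball x r" using y c x n by (simp add: q_def)
    qed
    then show ?thesis
      using c r(2) by (intro bexI[of _ "mball c q"]) (auto simp: \<B>_def q_def commute)
  qed
  moreover have "countable \<B>" unfolding \<B>_def using C(1) by auto
  moreover have "\<forall>V\<in>\<B>. openin mtopology V" by (auto simp: \<B>_def)
  ultimately show ?thesis unfolding second_countable_def T by blast
qed

text \<open>General countable index types allow a code with several kinds of coordinates to be one
  point of a Polish space.\<close>

lemma polish_euclidean_fun_nat: "polish (euclidean :: ('i::countable \<Rightarrow> nat) topology)"
proof -
  have "completely_metrizable_space (product_topology (\<lambda>_::'i. euclidean :: nat topology) UNIV)"
    by (subst completely_metrizable_space_product_topology)
      (metis completely_metrizable_space_discrete_topology countableI_type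
        discrete_topology_unique open_discrete open_openin topspace_euclidean)
  moreover have "second_countable (euclidean :: ('i \<Rightarrow> nat) topology)"
  proof -
    obtain B :: "('i \<Rightarrow> nat) set set" where "countable B" "topological_basis B"
      using ex_countable_basis by blast
    then show ?thesis
      unfolding second_countable_def
      by (intro exI[of _ B]) (metis open_openin topological_basisE topological_basis_open)
  qed
  ultimately show ?thesis
    by (simp add: polish_def euclidean_product_topology second_countable_imp_separable_space)
qed

text \<open>Zero-dimensionality alone gives a possibly uncountable clopen base. Choosing one clopen
  set between each pair of members of a countable base, whenever there is one, keeps it
  countable.\<close>

lemma countable_clopen_base:
  fixes Y :: "'y topology"
  assumes "second_countable Y" "Y dim_le 0"
  shows "\<exists>C :: nat \<Rightarrow> 'y set. (\<forall>i. openin Y (C i) \<and> closedin Y (C i)) \<and>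
    (\<forall>W y. openin Y W \<longrightarrow> y \<in> W \<longrightarrow> (\<exists>i. y \<in> C i \<and> C i \<subseteq> W))"
proof -
  have clopen: "\<exists>U. closedin Y U \<and> openin Y U \<and> y \<in> U \<and> U \<subseteq> W"
    if "openin Y W" "y \<in> W" for W y
    using assms(2) that
    by (simp add: dimension_le_0_neighbourhood_base_of_clopen open_neighbourhood_base_of)
  obtain \<B> where B: "countable \<B>" "\<And>V. V \<in> \<B> \<Longrightarrow> openin Y V"
    "\<And>U x. openin Y U \<Longrightarrow> x \<in> U \<Longrightarrow> \<exists>V\<in>\<B>. x \<in> V \<and> V \<subseteq> U"
    using assms(1) unfolding second_countable_def by metis
  define between where "between V W U \<longleftrightarrow> closedin Y U \<and> openin Y U \<and> V \<subseteq> U \<and> U \<subseteq> W" for V W U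
  \<comment> \<open>Inserting the empty set makes the family nonempty, so that
    \<open>from_nat_into\<close> enumerates exactly its members.\<close>
  define \<C> where "\<C> = insert {} ((\<lambda>(V, W). SOME U. between V W U) `
    {(V, W) \<in> \<B> \<times> \<B>. \<exists>U. between V W U})"
  have some: "between V W (SOME U. between V W U)" if "between V W U" for V W U
    using that by (rule someI)
  have "countable (\<B> \<times> \<B>)" using B(1) by (intro countable_SIGMA) simp_all
  then have "countable {(V, W) \<in> \<B> \<times> \<B>. \<exists>U. between V W U}"
    by (rule countable_subset[rotated]) auto
  then have count: "countable \<C>" unfolding \<C>_def by simp
  have cl: "openin Y U \<and> closedin Y U" if U: "U \<in> \<C>" for U
  proof (cases "U = {}")
    case False
    then obtain V W U' where "between V W U'" "U = (SOME U. between V W U)"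
      using U unfolding \<C>_def by blast
    then have "between V W U" using some by blast
    then show ?thesis by (simp add: between_def)
  qed simp
  have base: "\<exists>U\<in>\<C>. y \<in> U \<and> U \<subseteq> W" if W: "openin Y W" "y \<in> W" for W y
  proof -
    \<comment> \<open>The clopen set chosen for \<open>(V, W')\<close> may differ from
      \<open>U\<close>, but lying between \<open>V\<close> and \<open>W'\<close> it still contains
      \<open>y\<close> and stays inside \<open>W\<close>.\<close>
    obtain W' where W': "W' \<in> \<B>" "y \<in> W'" "W' \<subseteq> W" using B(3) W by blast
    obtain U where U: "closedin Y U" "openin Y U" "y \<in> U" "U \<subseteq> W'"
      using clopen[OF B(2)[OF W'(1)] W'(2)] by blast
    obtain V where V: "V \<in> \<B>" "y \<in> V" "V \<subseteq> U" using B(3) U by blast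
    have U: "between V W' U" using U V by (simp add: between_def)
    define U' where "U' = (SOME U. between V W' U)"
    have "U' \<in> \<C>"
      unfolding \<C>_def U'_def using V(1) W'(1) U by (intro insertI2 image_eqI[of _ _ "(V, W')"]) auto
    moreover have "V \<subseteq> U'" "U' \<subseteq> W'" using some[OF U] by (simp_all add: between_def U'_def)
    ultimately show ?thesis using V(2) W'(3) by blast
  qed
  have "\<C> \<noteq> {}" by (simp add: \<C>_def)
  then have C: "range (from_nat_into \<C>) = \<C>" using count by (rule range_from_nat_into)
  show ?thesis
  proof (intro exI[of _ "from_nat_into \<C>"] conjI allI impI)
    show "openin Y (from_nat_into \<C> i)" "closedin Y (from_nat_into \<C> i)" for i
      using cl[of "from_nat_into \<C> i"] C by blast+
    fix W y assume "openin Y W" "y \<in> W"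
    then obtain U where "U \<in> \<C>" "y \<in> U" "U \<subseteq> W" using base by blast
    then show "\<exists>i. y \<in> from_nat_into \<C> i \<and> from_nat_into \<C> i \<subseteq> W"
      using from_nat_into_surj[OF count] by metis
  qed
qed


section \<open>The powerset topology\<close>

lemma topspace_powerset_topology [simp]: "topspace powerset_topology = UNIV"
  by (simp add: powerset_topology_def topspace_pullback_topology)

lemma homeomorphic_powerset_topology:
  "(powerset_topology :: 'a set topology) homeomorphic_space
    product_topology (\<lambda>_. discrete_topology (UNIV :: bool set)) (UNIV :: 'a set)"
proof -
  have "homeomorphic_maps powerset_topology
    (product_topology (\<lambda>_. discrete_topology (UNIV :: bool set)) (UNIV :: 'a set)) (\<lambda>A x. x \<in> A) Collect"
    unfolding homeomorphic_maps_def
  proof (intro conjI)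
    show "continuous_map powerset_topology
       (product_topology (\<lambda>_. discrete_topology (UNIV :: bool set)) UNIV) (\<lambda>A x. x \<in> (A :: 'a set))"
      unfolding powerset_topology_def
      using continuous_map_pullback[OF continuous_map_id] by (simp add: o_def id_def)
    show "continuous_map (product_topology (\<lambda>_. discrete_topology (UNIV :: bool set)) UNIV)
       (powerset_topology :: 'a set topology) Collect"
      unfolding powerset_topology_def
      by (rule continuous_map_pullback') (auto simp: o_def)
  qed auto
  then show ?thesis unfolding homeomorphic_space_def by blast
qed

lemma openin_powerset_member: "openin powerset_topology {A. x \<in> A \<longleftrightarrow> b}"
proof -
  have "continuous_map powerset_topology (discrete_topology UNIV) (\<lambda>A. x \<in> A)"
    unfolding powerset_topology_def
    using continuous_map_pullback[OF continuous_map_product_projection[of x UNIV]]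
    by (simp add: o_def)
  then have "openin powerset_topology {A \<in> topspace powerset_topology. (x \<in> A) \<in> {b}}"
    by (rule openin_continuous_map_preimage) simp
  then show ?thesis by simp
qed

text \<open>Continuity into a product is coordinatewise, and into a discrete factor it means that
  membership of each fixed point is locally constant.\<close>

lemma continuous_map_powerset:
  assumes "\<And>x y. y \<in> topspace T \<Longrightarrow>
    \<exists>W. openin T W \<and> y \<in> W \<and> (\<forall>z\<in>W. x \<in> F z \<longleftrightarrow> x \<in> F y)"
  shows "continuous_map T powerset_topology F"
proof -
  have "continuous_map T (discrete_topology UNIV) (\<lambda>y. x \<in> F y)" for x
    unfolding continuous_map_def
  proof (intro conjI allI impI)
    fix U :: "bool set"
    show "openin T {y \<in> topspace T. (x \<in> F y) \<in> U}"
    proof (subst openin_subopen, intro ballI)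
      fix y assume y: "y \<in> {y \<in> topspace T. (x \<in> F y) \<in> U}"
      then have "y \<in> topspace T" by simp
      from assms[OF this, where x = x]
      obtain W where W: "openin T W \<and> y \<in> W \<and> (\<forall>z\<in>W. x \<in> F z \<longleftrightarrow> x \<in> F y)" ..
      have "z \<in> {y \<in> topspace T. (x \<in> F y) \<in> U}" if "z \<in> W" for z
      proof -
        have "(x \<in> F z) = (x \<in> F y)" using W that by blast
        moreover have "z \<in> topspace T" using W that openin_subset by blast
        ultimately show ?thesis using y by simp
      qed
      then have "W \<subseteq> {y \<in> topspace T. (x \<in> F y) \<in> U}" by (rule subsetI)
      then show "\<exists>W. openin T W \<and> y \<in> W \<and> W \<subseteq> {y \<in> topspace T. (x \<in> F y) \<in> U}"
        using W by blast
    qed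
  qed simp
  then have "continuous_map T (product_topology (\<lambda>_. discrete_topology UNIV) UNIV)
      ((\<lambda>A x. x \<in> A) \<circ> F)"
    by (simp add: o_def continuous_map_componentwise_UNIV)
  then show ?thesis
    unfolding powerset_topology_def by (rule continuous_map_pullback') simp
qed

lemma continuous_map_powerset_euclidean:
  fixes F :: "'t::topological_space \<Rightarrow> 'a set"
  assumes "\<And>x y. \<forall>\<^sub>F z in nhds y. x \<in> F z \<longleftrightarrow> x \<in> F y"
  shows "continuous_map euclidean powerset_topology F"
proof (rule continuous_map_powerset)
  fix x and y :: 't
  show "\<exists>W. openin euclidean W \<and> y \<in> W \<and> (\<forall>z\<in>W. x \<in> F z \<longleftrightarrow> x \<in> F y)"
    using assms[of x y] by (simp only: eventually_nhds open_openin[symmetric])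
qed

lemma eventually_coordinate_eq:
  fixes y :: "'i::countable \<Rightarrow> nat"
  shows "\<forall>\<^sub>F z in nhds y. z i = y i"
proof -
  have "open ((\<lambda>z. z i) -` {y i})"
    by (intro open_vimage continuous_on_product_coordinates open_discrete)
  then show ?thesis
    unfolding eventually_nhds by (intro exI[of _ "(\<lambda>z. z i) -` {y i}"]) simp
qed

lemma polish_powerset_topology: "polish (powerset_topology :: 'a::countable set topology)"
  unfolding polish_def
proof
  have "completely_metrizable_space
      (product_topology (\<lambda>_. discrete_topology (UNIV :: bool set)) (UNIV :: 'a set))"
    by (simp add: completely_metrizable_space_product_topology
        completely_metrizable_space_discrete_topology)
  then show "completely_metrizable_space (powerset_topology :: 'a set topology)"
    using homeomorphic_completely_metrizable_space[OF homeomorphic_powerset_topology] by blast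
  \<comment> \<open>Separability is inherited from the separable space of functions into
    \<open>nat\<close>, by the continuous surjection sending a function to its support.\<close>
  define F :: "('a \<Rightarrow> nat) \<Rightarrow> 'a set" where "F g = {x. g x \<noteq> 0}" for g
  have "continuous_map euclidean powerset_topology F"
  proof (rule continuous_map_powerset_euclidean)
    show "\<forall>\<^sub>F z in nhds y. x \<in> F z \<longleftrightarrow> x \<in> F y" for x y
      using eventually_coordinate_eq[of x y] by eventually_elim (simp add: F_def)
  qed
  moreover have "separable_space (euclidean :: ('a \<Rightarrow> nat) topology)"
    using polish_euclidean_fun_nat unfolding polish_def by blast
  moreover have "surj F"
  proof (rule surjI)
    show "F (indicator A) = A" for A by (auto simp: F_def indicator_def)
  qed
  then have "F ` topspace euclidean = topspace powerset_topology" by simp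
  ultimately show "separable_space (powerset_topology :: 'a set topology)"
    using separable_space_continuous_map_image[of euclidean powerset_topology F] by simp
qed


section \<open>Monitorable sets of the tree\<close>

instance tree_top :: countable
  by countable_datatype

text \<open>Nonempty Scott open sets pairwise intersect, so monitorability only has to be
  tested on the whole space.\<close>

lemma monitorable_scott_iff:
  fixes A :: "tree_top set"
  shows "monitorable scott_topology A \<longleftrightarrow>
    (\<exists>V. openin scott_topology V \<and> V \<noteq> {} \<and> (V \<subseteq> A \<or> V \<subseteq> -A))"
proof
  assume "monitorable scott_topology A"
  \<comment> \<open>Monitorability is tested on \<open>UNIV\<close>: a point outside one of the two
    closures has an open neighbourhood missing \<open>A\<close> or \<open>-A\<close>.\<close>
  moreover have "openin scott_topology (UNIV :: tree_top set)"
    using openin_topspace[of "scott_topology :: tree_top topology"] by simp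
  ultimately obtain x where
      "x \<notin> scott_topology closure_of A \<or> x \<notin> scott_topology closure_of (- A)"
    unfolding monitorable_def by (auto simp: Compl_eq_Diff_UNIV)
  then show "\<exists>V. openin scott_topology V \<and> V \<noteq> {} \<and> (V \<subseteq> A \<or> V \<subseteq> -A)"
    unfolding in_closure_of by fastforce
next
  assume "\<exists>V. openin scott_topology V \<and> V \<noteq> {} \<and> (V \<subseteq> A \<or> V \<subseteq> -A)"
  then obtain V where V: "openin scott_topology V" "V \<noteq> {}" "V \<subseteq> A \<or> V \<subseteq> -A" by blast
  have Infty: "Infty \<in> U" if "openin scott_topology U" "U \<noteq> {}" for U
    using that unfolding openin_scott_topology by (meson ex_in_conv scott_openD(1) tree_top_le_simps(2))
  show "monitorable scott_topology A"
    unfolding monitorable_def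
  proof (intro allI impI)
    fix U :: "tree_top set"
    assume "openin scott_topology U \<and> U \<noteq> {}"
    then have "Infty \<in> U" using Infty by blast
    moreover have "Infty \<in> V" using Infty V by blast
    then have "Infty \<notin> scott_topology closure_of A \<or>
        Infty \<notin> scott_topology closure_of (topspace scott_topology - A)"
      using V by (auto simp: in_closure_of)
    ultimately show "\<not> U \<subseteq> scott_topology closure_of A \<or>
        \<not> U \<subseteq> scott_topology closure_of (topspace scott_topology - A)" by blast
  qed
qed

text \<open>A nonempty open set meets each branch and, being upward closed, contains every extension
  of the meeting node and the top element. Conversely, the largest upward closed subset of
  \<open>A\<close> is open once it meets every branch.\<close>

lemma contains_nonempty_scott_open_iff:
  "(\<exists>V. openin scott_topology V \<and> V \<noteq> {} \<and> V \<subseteq> A) \<longleftrightarrow>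
    Infty \<in> A \<and> (\<forall>\<alpha>. \<exists>n. \<forall>w. Seq (map \<alpha> [0..<n] @ w) \<in> A)"
proof
  assume "\<exists>V. openin scott_topology V \<and> V \<noteq> {} \<and> V \<subseteq> A"
  then obtain V where V: "V \<noteq> {}" "V \<subseteq> A" "\<And>x y. x \<in> V \<Longrightarrow> x \<le> y \<Longrightarrow> y \<in> V"
    "\<And>\<alpha>. V \<inter> infinite_branch \<alpha> \<noteq> {}"
    unfolding openin_scott_tree_top by metis
  have "\<exists>n. \<forall>w. Seq (map \<alpha> [0..<n] @ w) \<in> A" for \<alpha>
  proof -
    obtain n where "Seq (map \<alpha> [0..<n]) \<in> V" using V(4)[of \<alpha>] by (auto simp: infinite_branch_def)
    then show ?thesis using V(2,3) by (meson prefixI subsetD tree_top_le_simps(1))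
  qed
  then show "Infty \<in> A \<and> (\<forall>\<alpha>. \<exists>n. \<forall>w. Seq (map \<alpha> [0..<n] @ w) \<in> A)"
    using V(1-3) by (metis ex_in_conv subsetD tree_top_le_simps(2))
next
  assume A: "Infty \<in> A \<and> (\<forall>\<alpha>. \<exists>n. \<forall>w. Seq (map \<alpha> [0..<n] @ w) \<in> A)"
  define V where "V = {x. \<forall>y. x \<le> y \<longrightarrow> y \<in> A}"
  have "Seq s \<in> V" if "\<forall>w. Seq (s @ w) \<in> A" for s
    using that A unfolding V_def by (auto simp: less_eq_tree_top_def prefix_def)
  then have "V \<inter> infinite_branch \<alpha> \<noteq> {}" for \<alpha>
    using A unfolding infinite_branch_def by blast
  moreover have "\<forall>x\<in>V. \<forall>y. x \<le> y \<longrightarrow> y \<in> V" unfolding V_def using order_trans by blast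
  moreover have "V \<noteq> {}" "V \<subseteq> A"
    using calculation(1) by (auto simp: V_def)
  ultimately show "\<exists>V. openin scott_topology V \<and> V \<noteq> {} \<and> V \<subseteq> A"
    unfolding openin_scott_tree_top by blast
qed

text \<open>The previous criterion is applied to \<open>A\<close> and to \<open>-A\<close>; whether
  \<open>Infty\<close> lies in \<open>A\<close> decides which of the two can hold. Both halves of
  the theorem rest on this form.\<close>

lemma monitorable_sets_scott:
  "A \<in> monitorable_sets scott_topology \<longleftrightarrow>
    (\<forall>\<alpha>. \<exists>n. \<forall>w. Seq (map \<alpha> [0..<n] @ w) \<in> A \<longleftrightarrow> Infty \<in> A)"
proof -
  have "A \<in> monitorable_sets scott_topology \<longleftrightarrow>
      (\<exists>V. openin scott_topology V \<and> V \<noteq> {} \<and> V \<subseteq> A) \<or>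
      (\<exists>V. openin scott_topology V \<and> V \<noteq> {} \<and> V \<subseteq> -A)"
    unfolding monitorable_sets_def by (simp add: monitorable_scott_iff) blast
  then show ?thesis
    unfolding contains_nonempty_scott_open_iff by (cases "Infty \<in> A") simp_all
qed


section \<open>Coanalyticity\<close>

text \<open>A witness against monitorability is a branch together with, for each initial segment, an
  extension disagreeing with \<open>Infty\<close>. The complement is the continuous image of the
  space of codes for a set and such a witness.\<close>

lemma coanalytic_monitorable_sets_scott:
  "coanalytic_in powerset_topology (monitorable_sets (scott_topology :: tree_top topology))"
proof -
  \<comment> \<open>\<open>Inr (Inl i)\<close> holds the branch and \<open>Inr (Inr n)\<close> the
    code of the n-th extension. Since \<open>from_nat\<close> is total, every
    \<open>\<gamma>\<close> is a legitimate code.\<close>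
  define t :: "(tree_top + nat + nat \<Rightarrow> nat) \<Rightarrow> nat \<Rightarrow> nat list" where
    "t \<gamma> n = map (\<lambda>i. \<gamma> (Inr (Inl i))) [0..<n] @ from_nat (\<gamma> (Inr (Inr n)))" for \<gamma> n
  text \<open>The set coded by the first coordinates of \<open>\<gamma>\<close>, corrected on the extensions \<open>t \<gamma> n\<close> of the
    initial segments of a branch so that they disagree with \<open>Infty\<close>. It is continuous
    since \<open>t \<gamma> n\<close> has length at least \<open>n\<close>.\<close>
  define F :: "(tree_top + nat + nat \<Rightarrow> nat) \<Rightarrow> tree_top set" where
    "F \<gamma> = {x. if \<exists>n. x = Seq (t \<gamma> n) then \<gamma> (Inl Infty) = 0 else \<gamma> (Inl x) \<noteq> 0}" for \<gamma>
  \<comment> \<open>The bound 0 at \<open>Infty\<close> is a default, as \<open>Infty\<close> never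
    has the form \<open>Seq (t \<gamma> n)\<close>.\<close>
  have bounded: "(\<exists>n. x = Seq (t \<gamma> n)) \<longleftrightarrow>
      (\<exists>n \<le> (case x of Seq s \<Rightarrow> length s | Infty \<Rightarrow> 0). x = Seq (t \<gamma> n))"
    for x \<gamma>
  proof -
    have "n \<le> (case x of Seq s \<Rightarrow> length s | Infty \<Rightarrow> 0)" if "x = Seq (t \<gamma> n)" for n
      using that by (simp add: t_def)
    then show ?thesis by blast
  qed
  have "continuous_map euclidean powerset_topology F"
  proof (rule continuous_map_powerset_euclidean)
    fix x and \<gamma> :: "tree_top + nat + nat \<Rightarrow> nat"
    define N where "N = (case x of Seq s \<Rightarrow> length s | Infty \<Rightarrow> 0)"
    have "\<forall>\<^sub>F \<delta> in nhds \<gamma>.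
        \<forall>i\<in>{Inl x, Inl Infty} \<union> (Inr \<circ> Inl) ` {..N} \<union> (Inr \<circ> Inr) ` {..N}. \<delta> i = \<gamma> i"
      by (intro eventually_ball_finite ballI eventually_coordinate_eq) auto
    then show "\<forall>\<^sub>F \<delta> in nhds \<gamma>. x \<in> F \<delta> \<longleftrightarrow> x \<in> F \<gamma>"
    proof eventually_elim
      case (elim \<delta>)
      then have "t \<delta> n = t \<gamma> n" if "n \<le> N" for n
        using that by (auto simp: t_def)
      then have "(\<exists>n. x = Seq (t \<delta> n)) \<longleftrightarrow> (\<exists>n. x = Seq (t \<gamma> n))"
        unfolding bounded N_def[symmetric] by auto
      then show ?case using elim by (simp add: F_def)
    qed
  qed
  then have "analytic_in powerset_topology (range F)"
    using analytic_in_image[OF polish_powerset_topology polish_euclidean_fun_nat] by fastforce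
  moreover have "range F = - monitorable_sets scott_topology"
  proof (intro equalityI subsetI)
    fix A assume "A \<in> range F"
    then obtain \<gamma> where A: "A = F \<gamma>" by blast
    have "(Seq (t \<gamma> n) \<in> A) \<noteq> (Infty \<in> A)" for n
      unfolding A F_def by auto
    then show "A \<in> - monitorable_sets scott_topology"
      unfolding Compl_iff monitorable_sets_scott t_def by blast
  next
    fix A :: "tree_top set" assume "A \<in> - monitorable_sets scott_topology"
    then obtain \<alpha> w where w: "\<And>n. (Seq (map \<alpha> [0..<n] @ w n) \<in> A) \<noteq> (Infty \<in> A)"
      unfolding Compl_iff monitorable_sets_scott by metis
    \<comment> \<open>The extensions \<open>w n\<close> already disagree with \<open>Infty\<close>,
      so the correction made by \<open>F\<close> leaves \<open>A\<close> unchanged.\<close>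
    define \<gamma> :: "tree_top + nat + nat \<Rightarrow> nat" where
      "\<gamma> = case_sum (indicator A) (case_sum \<alpha> (\<lambda>n. to_nat (w n)))"
    have t: "t \<gamma> n = map \<alpha> [0..<n] @ w n" for n by (simp add: t_def \<gamma>_def)
    have "F \<gamma> = A"
      using w by (auto simp: F_def t) (auto simp: \<gamma>_def indicator_def split: if_splits)
    then show "A \<in> range F" by blast
  qed
  ultimately show ?thesis by (simp add: coanalytic_in_def Compl_eq_Diff_UNIV)
qed


section \<open>Completeness\<close>

text \<open>The constructed \<open>F y\<close> is closed under initial segments, so the right-hand
  side says that this tree has an infinite branch; the form with \<open>w\<close> matches the
  negation of \<open>monitorable_sets_scott\<close>.\<close>

lemma analytic_imp_reduction:
  fixes Y :: "'y topology"
  assumes Y: "polish Y" "Y dim_le 0" and E: "analytic_in Y E"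
  shows "\<exists>F :: 'y \<Rightarrow> nat list set. continuous_map Y powerset_topology F \<and>
    (\<forall>y\<in>topspace Y. y \<in> E \<longleftrightarrow> (\<exists>\<alpha>. \<forall>n. \<exists>w. map \<alpha> [0..<n] @ w \<in> F y))"
proof -
  obtain C :: "nat \<Rightarrow> 'y set" where clopen_base:
    "(\<forall>i. openin Y (C i) \<and> closedin Y (C i)) \<and>
      (\<forall>W y. openin Y W \<longrightarrow> y \<in> W \<longrightarrow> (\<exists>i. y \<in> C i \<and> C i \<subseteq> W))"
    using countable_clopen_base[OF polish_imp_second_countable[OF Y(1)] Y(2)] ..
  then have C: "openin Y (C i)" "closedin Y (C i)" for i by blast+
  obtain P :: "(nat \<Rightarrow> nat) topology" and f
    where P: "polish P" "continuous_map P Y f" "f ` topspace P = E"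
    using E unfolding analytic_in_def by blast
  obtain M d where Md: "Metric_space M d" and PM: "P = Metric_space.mtopology M d"
    and complete: "Metric_space.mcomplete M d"
    using P(1) unfolding polish_def completely_metrizable_space_def by blast
  interpret Metric_space M d by (fact Md)
  obtain D where D: "countable D" "D \<subseteq> M" "mtopology closure_of D = M"
    using P(1) unfolding polish_def separable_space_def PM by auto
  define e where "e = from_nat_into D"
  \<comment> \<open>The point \<open>x\<close> guarantees that \<open>M\<close>, and hence
    \<open>D\<close>, is nonempty; otherwise \<open>from_nat_into D\<close> would return a default
    value.\<close>
  have e: "e i \<in> M" if "x \<in> M" for x i
  proof -
    have "D \<noteq> {}" using that D(3) by auto
    then show ?thesis using D(2) from_nat_into[of D i] unfolding e_def by blast
  qed
  text \<open>Only the cells \<open>C i\<close> with \<open>i < length s\<close> are consulted about \<open>y\<close>, which makes \<open>F\<close> continuous.\<close>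
  define Q where "Q y s x \<longleftrightarrow> x \<in> M \<and>
    (\<forall>i<length s. d x (e (s ! i)) \<le> (1/2) ^ i \<and> (f x \<in> C i \<longleftrightarrow> y \<in> C i))" for y s x
  define F where "F y = {s. \<exists>x. Q y s x}" for y
  show ?thesis
  proof (intro exI[of _ F] conjI ballI)
    show "continuous_map Y powerset_topology F"
    proof (rule continuous_map_powerset)
      fix s :: "nat list" and y assume y: "y \<in> topspace Y"
      \<comment> \<open>Because the cells are clopen, agreeing with \<open>y\<close> on finitely
        many of them is an open condition.\<close>
      define V where "V i = (if y \<in> C i then C i else topspace Y - C i)" for i
      define W where "W = topspace Y \<inter> (\<Inter>i<length s. V i)"
      have "openin Y (V i)" for i
        using C(1,2) by (simp add: V_def openin_diff)
      then have "openin Y W"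
        unfolding W_def
        by (cases "length s = 0") (auto intro!: openin_Int openin_INT2 simp: lessThan_empty_iff)
      moreover have "y \<in> W" using y by (auto simp: W_def V_def)
      moreover have "s \<in> F z \<longleftrightarrow> s \<in> F y" if "z \<in> W" for z
      proof -
        have "z \<in> C i \<longleftrightarrow> y \<in> C i" if "i < length s" for i
          using that \<open>z \<in> W\<close> by (auto simp: W_def V_def split: if_splits)
        then show ?thesis by (simp add: F_def Q_def)
      qed
      ultimately show "\<exists>W. openin Y W \<and> y \<in> W \<and> (\<forall>z\<in>W. s \<in> F z \<longleftrightarrow> s \<in> F y)" by blast
    qed
  next
    fix y assume y: "y \<in> topspace Y"
    show "y \<in> E \<longleftrightarrow> (\<exists>\<alpha>. \<forall>n. \<exists>w. map \<alpha> [0..<n] @ w \<in> F y)"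
    proof
      assume "y \<in> E"
      then obtain x where x: "x \<in> M" "f x = y" using P(3) by (auto simp: PM)
      have "\<exists>k. d x (e k) \<le> (1/2) ^ i" for i :: nat
      proof -
        have "x \<in> mtopology closure_of D" using x(1) D(3) by simp
        moreover have "(1/2::real) ^ i > 0" by simp
        ultimately obtain c where "c \<in> D" "c \<in> mball x ((1/2) ^ i)"
          unfolding metric_closure_of by blast
        then show ?thesis
          using from_nat_into_surj[OF D(1)] unfolding e_def by (metis in_mball less_imp_le)
      qed
      then obtain \<alpha> where "\<And>i. d x (e (\<alpha> i)) \<le> (1/2) ^ i" by metis
      then have "Q y (map \<alpha> [0..<n]) x" for n using x by (simp add: Q_def)
      then have "map \<alpha> [0..<n] @ [] \<in> F y" for n unfolding F_def by auto
      then show "\<exists>\<alpha>. \<forall>n. \<exists>w. map \<alpha> [0..<n] @ w \<in> F y" by blast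
    next
      assume "\<exists>\<alpha>. \<forall>n. \<exists>w. map \<alpha> [0..<n] @ w \<in> F y"
      then obtain \<alpha> where "\<forall>n. \<exists>w x. Q y (map \<alpha> [0..<n] @ w) x"
        unfolding F_def by blast
      then obtain w x where Q: "\<And>n. Q y (map \<alpha> [0..<n] @ w n) (x n)"
        by metis
      have xM: "x n \<in> M" for n using Q by (simp add: Q_def)
      have close: "d (x n) (e (\<alpha> i)) \<le> (1/2) ^ i" and cell: "f (x n) \<in> C i \<longleftrightarrow> y \<in> C i"
        if "i < n" for n i
      proof -
        have "i < length (map \<alpha> [0..<n] @ w n)" "(map \<alpha> [0..<n] @ w n) ! i = \<alpha> i"
          using that by (simp_all add: nth_append)
        then show "d (x n) (e (\<alpha> i)) \<le> (1/2) ^ i" "f (x n) \<in> C i \<longleftrightarrow> y \<in> C i"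
          using Q[of n] unfolding Q_def by (metis, metis)
      qed
      \<comment> \<open>For every \<open>n > i\<close> the point \<open>x n\<close> is within
        \<open>(1/2) ^ i\<close> of the same centre \<open>e (\<alpha> i)\<close>.\<close>
      have "MCauchy x"
        unfolding MCauchy_def
      proof (intro conjI allI impI)
        show "range x \<subseteq> M" using xM by blast
        fix \<epsilon> :: real assume "\<epsilon> > 0"
        then obtain i where i: "(1/2) ^ i < \<epsilon> / 2"
          using real_arch_pow_inv[of "\<epsilon> / 2" "1/2"] by auto
        show "\<exists>N. \<forall>n n'. N \<le> n \<longrightarrow> N \<le> n' \<longrightarrow> d (x n) (x n') < \<epsilon>"
        proof (intro exI[of _ "Suc i"] allI impI)
          fix n n' assume n: "Suc i \<le> n" "Suc i \<le> n'"
          have "d (x n) (x n') \<le> d (x n) (e (\<alpha> i)) + d (e (\<alpha> i)) (x n')"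
            using xM e by (intro triangle) blast+
          also have "d (e (\<alpha> i)) (x n') = d (x n') (e (\<alpha> i))" by (rule commute)
          finally show "d (x n) (x n') < \<epsilon>" using close[of i n] close[of i n'] n i by simp
        qed
      qed
      then obtain l where l: "limitin mtopology x l sequentially"
        using complete unfolding mcomplete_def by blast
      then have lim: "limitin Y (f \<circ> x) (f l) sequentially"
        using continuous_map_limit[OF P(2)] by (simp add: PM)
      have "f l = y"
      proof (rule ccontr)
        \<comment> \<open>A cell around \<open>f l\<close> that excludes \<open>y\<close> contains
          \<open>f (x n)\<close> for large \<open>n\<close>, whereas for \<open>n > i\<close>
          membership of \<open>f (x n)\<close> in \<open>C i\<close> agrees with that of
          \<open>y\<close>.\<close>
        assume ne: "f l \<noteq> y"
        have "f l \<in> topspace Y" using lim by (simp add: limitin_def)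
        then obtain W where W: "openin Y W" "f l \<in> W" "y \<notin> W"
          using polish_imp_Hausdorff_space[OF Y(1)] ne y
          unfolding Hausdorff_space_def disjnt_iff by metis
        then obtain i where i: "f l \<in> C i" "y \<notin> C i" using clopen_base by blast
        have "\<forall>\<^sub>F n in sequentially. f (x n) \<in> C i"
          using lim C(1) i(1) by (simp add: limitin_def)
        moreover have "\<forall>\<^sub>F n in sequentially. i < n" by (rule eventually_gt_at_top)
        ultimately have "\<forall>\<^sub>F n in sequentially. False"
          by eventually_elim (use cell i(2) in blast)
        then show False by simp
      qed
      moreover have "l \<in> topspace P" using l by (simp add: PM limitin_def)
      ultimately show "y \<in> E" unfolding P(3)[symmetric] by (metis imageI)
    qed
  qed
qed

text \<open>The set \<open>f y\<close> always contains \<open>Infty\<close>, so it fails to be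
  monitorable exactly when some branch has all its initial segments extended into
  \<open>F y\<close>, that is, when \<open>y\<close> lies outside \<open>B\<close>.\<close>

lemma coanalytic_reduction_monitorable_sets_scott:
  fixes Y :: "'y topology"
  assumes "polish Y" "Y dim_le 0" "coanalytic_in Y B"
  shows "\<exists>f. continuous_map Y powerset_topology f \<and>
    B = {y \<in> topspace Y. f y \<in> monitorable_sets (scott_topology :: tree_top topology)}"
proof -
  have "analytic_in Y (topspace Y - B)" using assms(3) by (simp add: coanalytic_in_def)
  from analytic_imp_reduction[OF assms(1,2) this]
  obtain F :: "'y \<Rightarrow> nat list set" where F: "continuous_map Y powerset_topology F \<and>
    (\<forall>y\<in>topspace Y. y \<in> topspace Y - B \<longleftrightarrow>
      (\<exists>\<alpha>. \<forall>n. \<exists>w. map \<alpha> [0..<n] @ w \<in> F y))" ..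
  define f where "f y = - Seq ` F y" for y
  have "continuous_map powerset_topology powerset_topology (\<lambda>S. - Seq ` S)"
  proof (rule continuous_map_powerset)
    fix x and S :: "nat list set"
    show "\<exists>W. openin powerset_topology W \<and> S \<in> W \<and> (\<forall>S'\<in>W. x \<in> - Seq ` S' \<longleftrightarrow> x \<in> - Seq ` S)"
    proof (cases x)
      case (Seq s)
      then show ?thesis
        using openin_powerset_member[of s "s \<in> S"] by (intro exI conjI) auto
    next
      case Infty
      then show ?thesis
        using openin_topspace[of powerset_topology] by (intro exI[of _ UNIV]) auto
    qed
  qed
  then have "continuous_map Y powerset_topology f"
    using continuous_map_compose[OF conjunct1[OF F]] unfolding f_def o_def by blast
  moreover have "B = {y \<in> topspace Y. f y \<in> monitorable_sets scott_topology}"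
  proof -
    have "f y \<in> monitorable_sets scott_topology \<longleftrightarrow> y \<in> B" if "y \<in> topspace Y" for y
    proof -
      have "f y \<in> monitorable_sets scott_topology \<longleftrightarrow>
          \<not> (\<exists>\<alpha>. \<forall>n. \<exists>w. map \<alpha> [0..<n] @ w \<in> F y)"
        unfolding monitorable_sets_scott f_def by (simp add: image_iff)
      then show ?thesis using bspec[OF conjunct2[OF F] that] that by blast
    qed
    then show ?thesis using assms(3) unfolding coanalytic_in_def by blast
  qed
  ultimately show ?thesis by blast
qed

theorem proposition3p21:
  shows "coanalytic_complete TYPE('y) powerset_topology
           (monitorable_sets (scott_topology :: tree_top topology))"
  unfolding coanalytic_complete_def
proof (intro conjI allI impI)
  fix Y :: "'y topology" and B
  assume "polish Y \<and> Y dim_le 0 \<and> coanalytic_in Y B"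
  then show "\<exists>f. continuous_map Y powerset_topology f \<and>
      B = {y \<in> topspace Y. f y \<in> monitorable_sets (scott_topology :: tree_top topology)}"
    using coanalytic_reduction_monitorable_sets_scott[of Y B] by simp
qed (fact coanalytic_monitorable_sets_scott)

end
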